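(* Let $p\in[1,+\infty]$, let $C$ be a bivariate copula with $\mu_p(C)>0$, and let $\mu_0\in[0,\mu_p(C)]$. Set $$\alpha=\frac12\left(1+\frac{\mu_0}{\mu_p(C)}\right).$$ Then $\alpha\in[\tfrac12,1]$ and the mixed copula $C_\alpha=\alpha C+(1-\alpha)C^t$ satisfies $\mu_p(C_\alpha)=\mu_0$.
   Context: A (bivariate) copula is a function $C:[0,1]^2\to[0,1]$ with $C(t,0)=C(0,t)=0$, $C(t,1)=C(1,t)=t$ for all $t\in[0,1]$, and $C(u',v')-C(u,v')-C(u',v)+C(u,v)\ge 0$ whenever $u\le u'$, $v\le v'$ in $[0,1]$. The transpose is $C^t(u,v)=C(v,u)$. For $p\in[1,\infty)$, $\mu_p(C)=\left(\int_{[0,1]^2}|C(u,v)-C(v,u)|^p\,du\,dv\right)^{1/p}$, and $\mu_\infty(C)=\sup_{(u,v)\in[0,1]^2}|C(u,v)-C(v,u)|$. *)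

theory Defs
  imports "HOL-Analysis.Analysis"
begin

text \<open>A function on the unit square is represented by a total function on pairs of reals;
  its values outside the square are unconstrained and are never used.\<close>

definition copula :: "(real \<Rightarrow> real \<Rightarrow> real) \<Rightarrow> bool" where
  "copula C \<longleftrightarrow>
     (\<forall>u\<in>{0..1}. \<forall>v\<in>{0..1}. C u v \<in> {0..1}) \<and>
     (\<forall>t\<in>{0..1}. C t 0 = 0 \<and> C 0 t = 0 \<and> C t 1 = t \<and> C 1 t = t) \<and>
     (\<forall>u\<in>{0..1}. \<forall>u'\<in>{0..1}. \<forall>v\<in>{0..1}. \<forall>v'\<in>{0..1}.
        u \<le> u' \<longrightarrow> v \<le> v' \<longrightarrow> C u' v' - C u v' - C u' v + C u v \<ge> 0)"

definition copula_transpose :: "(real \<Rightarrow> real \<Rightarrow> real) \<Rightarrow> real \<Rightarrow> real \<Rightarrow> real" where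
  "copula_transpose C u v = C v u"

text \<open>The measure of asymmetry \<open>\<mu>\<^sub>p\<close>; it is meant for \<open>1 \<le> p \<le> \<infinity>\<close>.\<close>

definition copula_asymmetry :: "ennreal \<Rightarrow> (real \<Rightarrow> real \<Rightarrow> real) \<Rightarrow> real" where
  "copula_asymmetry p C =
     (if p = \<infinity> then (SUP (u, v)\<in>{0..1} \<times> {0..1}. \<bar>C u v - C v u\<bar>)
      else (LINT (u, v):{0..1} \<times> {0..1}|lborel. \<bar>C u v - C v u\<bar> powr enn2real p)
             powr (1 / enn2real p))"

end

theory Submission
  imports Defs
begin

text \<open>Mixing C with its transpose only rescales the asymmetry: C_\<alpha> - C_\<alpha>^t =
  (2\<alpha> - 1)(C - C^t). Since mu_p(C) is the L^p norm of C - C^t on the square, a factor c =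
  2\<alpha> - 1 \<ge> 0 comes out of it (\<open>copula_asymmetry_scale\<close>), and the prescribed
  \<alpha> is the one with c = \<open>\<mu>\<^sub>0\<close> / mu_p(C). That the mixture is again a
  copula follows from closure under transposition and convex combination.\<close>

lemma copula_copula_transpose:
  assumes "copula C"
  shows "copula (copula_transpose C)"
proof -
  \<comment> \<open>This is the rectangle inequality of \<open>C\<close> on the reflected rectangle
    [v, v'] x [u, u']; reflection merely exchanges the two mixed terms.\<close>
  have "C v' u' - C v' u - C v u' + C v u \<ge> 0"
    if "u \<in> {0..1}" "u' \<in> {0..1}" "v \<in> {0..1}" "v' \<in> {0..1}" "u \<le> u'" "v \<le> v'" for u u' v v'
    using assms that unfolding copula_def by (smt (verit))
  moreover have "\<forall>u\<in>{0..1}. \<forall>v\<in>{0..1}. C v u \<in> {0..1}"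
    "\<forall>t\<in>{0..1}. C t 0 = 0 \<and> C 0 t = 0 \<and> C t 1 = t \<and> C 1 t = t"
    using assms unfolding copula_def by blast+
  ultimately show ?thesis
    unfolding copula_def copula_transpose_def by (smt (verit))
qed

text \<open>Each copula axiom is an affine equation or inequality in the values of the function, so
  weights that are nonnegative and sum to 1 preserve it.\<close>

lemma copula_convex_combination:
  fixes a :: real
  assumes C: "copula C" and D: "copula D" and a: "0 \<le> a" "a \<le> 1"
  shows "copula (\<lambda>u v. a * C u v + (1 - a) * D u v)"
  unfolding copula_def
proof (intro conjI ballI impI)
  fix u v :: real
  assume uv: "u \<in> {0..1}" "v \<in> {0..1}"
  then have "C u v \<in> {0..1}" "D u v \<in> {0..1}"
    using C D by (auto simp: copula_def)
  then show "a * C u v + (1 - a) * D u v \<in> {0..1}"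
    using a convex_bound_le[of "C u v" 1 "D u v" a "1 - a"] by auto
next
  fix t :: real
  assume "t \<in> {0..1}"
  then have *: "C t 0 = 0" "C 0 t = 0" "C t 1 = t" "C 1 t = t"
      "D t 0 = 0" "D 0 t = 0" "D t 1 = t" "D 1 t = t"
    using C D unfolding copula_def by blast+
  show "a * C t 0 + (1 - a) * D t 0 = 0" "a * C 0 t + (1 - a) * D 0 t = 0"
    "a * C t 1 + (1 - a) * D t 1 = t" "a * C 1 t + (1 - a) * D 1 t = t"
    by (simp_all add: * algebra_simps)
next
  fix u u' v v' :: real
  assume "u \<in> {0..1}" "u' \<in> {0..1}" "v \<in> {0..1}" "v' \<in> {0..1}" "u \<le> u'" "v \<le> v'"
  then have "C u' v' - C u v' - C u' v + C u v \<ge> 0" "D u' v' - D u v' - D u' v + D u v \<ge> 0"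
    using C D unfolding copula_def by blast+
  then have "a * (C u' v' - C u v' - C u' v + C u v)
      + (1 - a) * (D u' v' - D u v' - D u' v + D u v) \<ge> 0"
    using a by simp
  then show "a * C u' v' + (1 - a) * D u' v' - (a * C u v' + (1 - a) * D u v')
      - (a * C u' v + (1 - a) * D u' v) + (a * C u v + (1 - a) * D u v) \<ge> 0"
    by (simp add: algebra_simps)
qed

text \<open>Multiplication by \<open>c\<close> \<ge> 0 is monotone and continuous, hence commutes
  with suprema of nonempty bounded sets.\<close>

lemma cSUP_mult_left:
  fixes f :: "'a \<Rightarrow> real"
  assumes "0 \<le> c" "A \<noteq> {}" "bdd_above (f ` A)"
  shows "(SUP x\<in>A. c * f x) = c * (SUP x\<in>A. f x)"
  using continuous_at_Sup_mono[of "\<lambda>x. c * x" "f ` A"] assms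
  by (simp add: mono_def mult_left_mono image_image continuous_intros)

text \<open>The measure sees a function only through its difference with the transpose, and is
  positively homogeneous in that difference.\<close>

lemma copula_asymmetry_scale:
  fixes c :: real
  assumes "1 \<le> p" "copula C" "0 \<le> c"
    and diff: "\<And>u v. D u v - D v u = c * (C u v - C v u)"
  shows "copula_asymmetry p D = c * copula_asymmetry p C"
proof -
  have abs_diff: "\<bar>D u v - D v u\<bar> = c * \<bar>C u v - C v u\<bar>" for u v
    using \<open>0 \<le> c\<close> by (simp add: diff abs_mult)
  show ?thesis
  proof (cases "p = \<infinity>")
    case True
    \<comment> \<open>A real supremum is meaningful only for a bounded set; two values in [0,1]
      differ by at most 1.\<close>
    have "bdd_above ((\<lambda>(u, v). \<bar>C u v - C v u\<bar>) ` ({0..1} \<times> {0..1}))"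
    proof (rule bdd_aboveI2[where M = 1], clarify)
      fix u v :: real
      assume "u \<in> {0..1}" "v \<in> {0..1}"
      then have "C u v \<in> {0..1}" "C v u \<in> {0..1}"
        using \<open>copula C\<close> unfolding copula_def by blast+
      then show "\<bar>C u v - C v u\<bar> \<le> 1" by auto
    qed
    then show ?thesis
      using True \<open>0 \<le> c\<close>
        cSUP_mult_left[of c "{0..1} \<times> {0..1}" "\<lambda>(u, v). \<bar>C u v - C v u\<bar>"]
      by (simp add: copula_asymmetry_def abs_diff case_prod_unfold)
  next
    case False
    define r where "r = enn2real p"
    define I where
      "I = (LINT (u, v):{0..1} \<times> {0..1}|lborel. \<bar>C u v - C v u\<bar> powr r)"
    have "ennreal 1 \<le> p" "p < top"
      using \<open>1 \<le> p\<close> False by (simp_all add: top.not_eq_extremum)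
    then have "1 \<le> r"
      unfolding r_def by (metis enn2real_ennreal enn2real_mono zero_le_one)
    have "I \<ge> 0"
      unfolding I_def set_lebesgue_integral_def
      by (intro Bochner_Integration.integral_nonneg) (auto simp: case_prod_unfold)
    \<comment> \<open>A constant factor leaves the Bochner integral unconditionally, because a
      non-integrable function has integral 0 by default.\<close>
    have "(LINT (u, v):{0..1} \<times> {0..1}|lborel. \<bar>D u v - D v u\<bar> powr r) = c powr r * I"
      using \<open>0 \<le> c\<close> unfolding I_def by (simp add: abs_diff powr_mult case_prod_unfold)
    then have "copula_asymmetry p D = (c powr r * I) powr (1 / r)"
      using False by (simp add: copula_asymmetry_def r_def)
    also have "\<dots> = c * I powr (1 / r)"
      \<comment> \<open>The exponents cancel, (c^r)^(1/r) = c, because r is nonzero; for c = 0 both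
        sides vanish since \<open>0 powr x = 0\<close>.\<close>
      using \<open>0 \<le> c\<close> \<open>I \<ge> 0\<close> \<open>1 \<le> r\<close> by (simp add: powr_mult powr_powr)
    also have "I powr (1 / r) = copula_asymmetry p C"
      using False by (simp add: copula_asymmetry_def r_def I_def)
    finally show ?thesis .
  qed
qed

theorem corollary6:
  fixes p :: ennreal
    and C :: "real \<Rightarrow> real \<Rightarrow> real"
    and \<mu>\<^sub>0 \<alpha> :: real
    and C\<^sub>\<alpha> :: "real \<Rightarrow> real \<Rightarrow> real"
  assumes "1 \<le> p"
    and "copula C"
    and "copula_asymmetry p C > 0"
    and "\<mu>\<^sub>0 \<in> {0..copula_asymmetry p C}"
    and "\<alpha> = 1 / 2 * (1 + \<mu>\<^sub>0 / copula_asymmetry p C)"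
    and "C\<^sub>\<alpha> = (\<lambda>u v. \<alpha> * C u v + (1 - \<alpha>) * copula_transpose C u v)"
  shows "\<alpha> \<in> {1 / 2..1} \<and> copula C\<^sub>\<alpha> \<and> copula_asymmetry p C\<^sub>\<alpha> = \<mu>\<^sub>0"
proof -
  define c where "c = \<mu>\<^sub>0 / copula_asymmetry p C"
  have c: "0 \<le> c" "c \<le> 1" and \<alpha>: "\<alpha> = (1 + c) / 2"
    using assms by (auto simp: c_def)
  \<comment> \<open>The transpose changes the sign of the difference, leaving the factor \<alpha> -
    (1 - \<alpha>) = \<open>c\<close>.\<close>
  have "C\<^sub>\<alpha> u v - C\<^sub>\<alpha> v u = c * (C u v - C v u)" for u v
    by (simp add: assms(6) copula_transpose_def \<alpha> field_simps)
  then have "copula_asymmetry p C\<^sub>\<alpha> = c * copula_asymmetry p C"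
    using copula_asymmetry_scale assms(1,2) c(1) by blast
  also have "\<dots> = \<mu>\<^sub>0"
    using assms(3) by (simp add: c_def)
  finally have "copula_asymmetry p C\<^sub>\<alpha> = \<mu>\<^sub>0" .
  moreover have "copula C\<^sub>\<alpha>"
    unfolding assms(6) using assms(2) c \<alpha>
    by (intro copula_convex_combination copula_copula_transpose) auto
  ultimately show ?thesis
    using c \<alpha> by simp
qed

end
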